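(* For each $n$, let $\mathbb P_n$ and $\mathbb Q_n$ be probability measures on a measurable space $(\mathsf Z_n,\mathcal Z_n)$. If $(\mathbb Q_n)$ is exponentially separated from $(\mathbb P_n)$, then $$\liminf_{n\to\infty}n^{-1}\,\mathrm{KL}(\mathbb P_n\|\mathbb Q_n)>0 .$$
   Context: $(\mathbb Q_n)$ is exponentially separated from $(\mathbb P_n)$ (written $(\mathbb Q_n)\dashv(\mathbb P_n)$) if there exists a sequence of sets $A_n\in\mathcal Z_n$ such that $\liminf_{n\to\infty}\mathbb P_n(A_n)>0$ and $\limsup_{n\to\infty}n^{-1}\log\mathbb Q_n(A_n)<0$ (with $\log0=-\infty$). The relative entropy is $\mathrm{KL}(\mathbb P\|\mathbb Q)=\int\log(d\mathbb P/d\mathbb Q)\,d\mathbb P$ if $\mathbb P\ll\mathbb Q$, and $\infty$ otherwise. *)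

theory Defs
  imports "HOL-Probability.Probability"
begin

text \<open>The library's \<^term>\<open>ln 0 = (0::real)\<close> would be wrong for events of probability zero.\<close>

definition ext_log :: "real \<Rightarrow> ereal" where
  "ext_log x = (if 0 < x then ereal (ln x) else -\<infinity>)"

definition exp_separated :: "(nat \<Rightarrow> 'a measure) \<Rightarrow> (nat \<Rightarrow> 'a measure) \<Rightarrow> bool"
  (infix "\<stileturn>" 50)
  where
  "Q \<stileturn> P \<longleftrightarrow>
     (\<exists>A. (\<forall>n. A n \<in> sets (P n)) \<and>
          liminf (\<lambda>n. ereal (measure (P n) (A n))) > 0 \<and>
          limsup (\<lambda>n. ereal (inverse (real n)) * ext_log (measure (Q n) (A n))) < 0)"

text \<open>
  \<^term>\<open>KL P Q\<close> is the relative entropy KL(P || Q), for measures on the same sigma-algebra; note that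
  \<^const>\<open>entropy_density\<close>, \<^const>\<open>KL_divergence\<close> and \<^const>\<open>absolutely_continuous\<close> take the dominating
  measure Q first. The library's \<^const>\<open>KL_divergence\<close> is real-valued and returns 0
  when the log-density is not integrable, so the integral is taken here in the extended sense,
  as positive part minus negative part. For probability measures the negative part is
  finite (\<open>KL_neg_part_finite\<close> below), so the difference is never of the form
  \<open>\<infinity> - \<infinity>\<close>.
\<close>

definition KL :: "'a measure \<Rightarrow> 'a measure \<Rightarrow> ereal" where
  "KL P Q =
     (if absolutely_continuous Q P
      then enn2ereal (\<integral>\<^sup>+x. ennreal (entropy_density (exp 1) Q P x) \<partial>P)
         - enn2ereal (\<integral>\<^sup>+x. ennreal (- entropy_density (exp 1) Q P x) \<partial>P)
      else \<infinity>)"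

lemma entropy_density_exp_1:
  "entropy_density (exp 1) Q P x = ln (enn2real (RN_deriv Q P x))"
  by (simp add: entropy_density_def log_def)

lemma KL_eq_KL_divergence:
  assumes "absolutely_continuous Q P" "integrable P (entropy_density (exp 1) Q P)"
  shows "KL P Q = ereal (KL_divergence (exp 1) Q P)"
proof -
  let ?f = "entropy_density (exp 1) Q P"
  have fin: "(\<integral>\<^sup>+x. ennreal (?f x) \<partial>P) \<noteq> \<infinity>" "(\<integral>\<^sup>+x. ennreal (- ?f x) \<partial>P) \<noteq> \<infinity>"
    using assms(2) by (auto simp: real_integrable_def)
  then have "enn2ereal (\<integral>\<^sup>+x. ennreal (?f x) \<partial>P) = ereal (enn2real (\<integral>\<^sup>+x. ennreal (?f x) \<partial>P))"
    "enn2ereal (\<integral>\<^sup>+x. ennreal (- ?f x) \<partial>P) = ereal (enn2real (\<integral>\<^sup>+x. ennreal (- ?f x) \<partial>P))"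
    by (metis enn2ereal_ennreal enn2real_nonneg ennreal_enn2real infinity_ennreal_def top.not_eq_extremum)+
  then show ?thesis
    using assms by (simp add: KL_def KL_divergence_def real_lebesgue_integral_def)
qed

lemma KL_neg_part_finite:
  assumes "prob_space P" "prob_space Q" "sets P = sets Q" "absolutely_continuous Q P"
  shows "(\<integral>\<^sup>+x. ennreal (- entropy_density (exp 1) Q P x) \<partial>P) < \<infinity>"
proof -
  interpret Q: prob_space Q by fact
  let ?r = "RN_deriv Q P"
  have fin: "AE x in Q. ?r x \<noteq> \<infinity>"
    using assms by (intro Q.RN_deriv_finite) (auto simp: prob_space_imp_sigma_finite)
  have pt: "d * ennreal (- ln (enn2real d)) \<le> 1" if "d \<noteq> \<infinity>" for d :: ennreal
  proof (cases d)
    case (real t)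
    show ?thesis
    proof (cases "0 < t")
      case True
      have "- ln t \<le> inverse t"
        using ln_le_minus_one[of "inverse t"] True by (simp add: ln_inverse)
      then have "t * max 0 (- ln t) \<le> 1"
        using True by (auto simp: max_def field_simps)
      then show ?thesis
        using real True
        by (metis enn2real_ennreal ennreal_1 ennreal_le_iff ennreal_max_0 ennreal_mult'
            less_eq_real_def zero_le_one)
    qed (use real in auto)
  qed (use that in auto)
  have "(\<integral>\<^sup>+x. ennreal (- entropy_density (exp 1) Q P x) \<partial>P)
      = (\<integral>\<^sup>+x. ?r x * ennreal (- entropy_density (exp 1) Q P x) \<partial>Q)"
    using assms by (intro Q.RN_deriv_nn_integral) auto
  also have "\<dots> \<le> (\<integral>\<^sup>+x. 1 \<partial>Q)"
    using fin by (intro nn_integral_mono_AE, eventually_elim) (auto simp: entropy_density_exp_1 pt)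
  also have "\<dots> < \<infinity>"
    by (simp add: Q.emeasure_space_1)
  finally show ?thesis .
qed

end

theory Submission
  imports Defs
begin

text \<open>
  By the variational (Donsker--Varadhan) bound, KL(P || Q) is at least the P-mean of g, plus 1,
  minus the Q-mean of exp g. If Q(A) is at most exp(-cn), take g to be cn on A and 0 elsewhere:
  then exp g has Q-mean at most 2, so KL(P || Q) is at least c n P(A) - 1.
\<close>

text \<open>With D the density of P with respect to Q, apply ln y <= y - 1 at y = exp (g x) / D x
  and integrate against P. The change of measure bounds the P-mean of exp g / D by the Q-mean of exp
  g. The bound is linear in that mean; since ln m <= m - 1, it is weaker than the form with its
  logarithm, but strong enough here.\<close>

lemma KL_ge_variational:
  fixes g :: "'a \<Rightarrow> real"
  assumes P: "prob_space P" and Q: "prob_space Q" and sets: "sets P = sets Q"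
    and g: "integrable P g" and eg: "integrable Q (\<lambda>x. exp (g x))"
  shows "ereal ((\<integral>x. g x \<partial>P) + 1 - (\<integral>x. exp (g x) \<partial>Q)) \<le> KL P Q"
proof -
  interpret P: prob_space P by fact
  interpret Q: prob_space Q by fact
  let ?f = "entropy_density (exp 1) Q P"
  have [measurable_cong]: "sets P = sets Q" by fact
  have [measurable]: "g \<in> borel_measurable Q"
    using borel_measurable_integrable[OF g] by (simp cong: measurable_cong_sets add: sets)
  have f_meas: "?f \<in> borel_measurable P"
    by (simp add: entropy_density_exp_1[abs_def])
  show ?thesis
  proof (cases "absolutely_continuous Q P")
    case ac: True
    \<comment> \<open>A finite negative part leaves two cases: an infinite positive part makes
      \<open>KL P Q\<close> infinite, and a finite one makes the log-density integrable, so that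
      \<open>KL P Q\<close> is an ordinary integral.\<close>
    have neg: "(\<integral>\<^sup>+x. ennreal (- ?f x) \<partial>P) < \<infinity>"
      using KL_neg_part_finite[OF P Q sets ac] .
    show ?thesis
    proof (cases "(\<integral>\<^sup>+x. ennreal (?f x) \<partial>P) = \<infinity>")
      case True
      with ac neg have "KL P Q = \<infinity>"
        by (cases "\<integral>\<^sup>+x. ennreal (- ?f x) \<partial>P") (auto simp: KL_def enn2ereal_ennreal)
      then show ?thesis by simp
    next
      case False
      with f_meas neg have int: "integrable P ?f"
        by (simp add: real_integrable_def)
      obtain D where D: "D \<in> borel_measurable Q" "AE x in Q. RN_deriv Q P x = ennreal (D x)"
        "AE x in P. 0 < D x" "\<And>x. 0 \<le> D x"
        using Q.real_RN_deriv[OF P.finite_measure_axioms ac sets] by metis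
      note [measurable] = D(1)
      have D_P: "AE x in P. RN_deriv Q P x = ennreal (D x)"
        using absolutely_continuous_AE[OF sets ac D(2)] .
      have "(\<integral>\<^sup>+x. ennreal (exp (g x) / D x) \<partial>P)
          = (\<integral>\<^sup>+x. RN_deriv Q P x * ennreal (exp (g x) / D x) \<partial>Q)"
        by (intro Q.RN_deriv_nn_integral[OF ac sets]) measurable
      \<comment> \<open>Only an inequality: D may vanish on a set of positive Q-measure, where the
        left integrand is 0 while exp (g x) is positive. Elsewhere the two integrands agree.\<close>
      also have "\<dots> \<le> (\<integral>\<^sup>+x. ennreal (exp (g x)) \<partial>Q)"
        using D(2)
      proof (intro nn_integral_mono_AE, eventually_elim)
        fix x assume "RN_deriv Q P x = ennreal (D x)"
        then show "RN_deriv Q P x * ennreal (exp (g x) / D x) \<le> ennreal (exp (g x))"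
          using D(4)[of x] by (cases "D x = 0") (simp_all flip: ennreal_mult)
      qed
      also have "\<dots> = ennreal (\<integral>x. exp (g x) \<partial>Q)"
        by (rule nn_integral_eq_integral[OF eg]) simp
      finally have le: "(\<integral>\<^sup>+x. ennreal (exp (g x) / D x) \<partial>P) \<le> ennreal (\<integral>x. exp (g x) \<partial>Q)" .
      have int_q: "integrable P (\<lambda>x. exp (g x) / D x)"
        using le D(4) by (intro integrableI_nonneg) (auto simp: top_unique less_top intro: le_less_trans)
      have "ennreal (\<integral>x. exp (g x) / D x \<partial>P) \<le> ennreal (\<integral>x. exp (g x) \<partial>Q)"
        using le D(4) by (subst nn_integral_eq_integral[OF int_q, symmetric]) auto
      then have le': "(\<integral>x. exp (g x) / D x \<partial>P) \<le> (\<integral>x. exp (g x) \<partial>Q)"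
        by (simp add: ennreal_le_iff integral_nonneg_AE)
      have "(\<integral>x. g x + 1 - exp (g x) / D x \<partial>P) \<le> (\<integral>x. ?f x \<partial>P)"
      proof (rule integral_mono_AE)
        \<comment> \<open>Positivity of D, available P-almost everywhere, is what allows ln (exp (g
          x) / D x) to be split as g x - ln (D x).\<close>
        show "AE x in P. g x + 1 - exp (g x) / D x \<le> ?f x"
          using D_P D(3)
        proof eventually_elim
          case (elim x)
          have "ln (exp (g x) / D x) \<le> exp (g x) / D x - 1"
            using elim by (intro ln_le_minus_one) simp
          with elim show ?case
            by (simp add: entropy_density_exp_1 ln_div)
        qed
      qed (use g int int_q in auto)
      moreover have "(\<integral>x. g x + 1 - exp (g x) / D x \<partial>P)
          = (\<integral>x. g x \<partial>P) + 1 - (\<integral>x. exp (g x) / D x \<partial>P)"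
        using g int_q by (simp add: P.prob_space)
      ultimately show ?thesis
        using le' KL_eq_KL_divergence[OF ac int] by (simp add: KL_divergence_def)
    qed
  qed (simp add: KL_def)
qed

text \<open>The Q-mean of exp g is 1 + (exp t - 1) Q(A), hence at most 2; the final -1 is the 1 of
  the variational bound minus this 2.\<close>

lemma KL_ge_event:
  assumes P: "prob_space P" and Q: "prob_space Q" and sets: "sets P = sets Q"
    and A: "A \<in> sets P" and le: "measure Q A \<le> exp (- t)"
  shows "ereal (t * measure P A - 1) \<le> KL P Q"
proof -
  interpret P: prob_space P by fact
  interpret Q: prob_space Q by fact
  let ?g = "\<lambda>x. t * indicator A x :: real"
  have AQ: "A \<in> sets Q" using A sets by simp
  have exp_g: "exp (?g x) = 1 + (exp t - 1) * indicator A x" for x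
    by (auto simp: indicator_def)
  have "exp t * measure Q A \<le> exp t * exp (- t)"
    using le by (intro mult_left_mono) auto
  also have "\<dots> = 1" by (simp flip: exp_add)
  finally have "(exp t - 1) * measure Q A \<le> 1"
    using measure_nonneg[of Q A] unfolding left_diff_distrib by linarith
  moreover have "(\<integral>x. exp (?g x) \<partial>Q) = 1 + (exp t - 1) * measure Q A"
    using AQ by (simp add: exp_g Q.prob_space Q.emeasure_eq_measure)
  moreover have "(\<integral>x. ?g x \<partial>P) = t * measure P A"
    using A by simp
  ultimately have "ereal (t * measure P A - 1) \<le> ereal ((\<integral>x. ?g x \<partial>P) + 1 - (\<integral>x. exp (?g x) \<partial>Q))"
    unfolding ereal_less_eq by linarith
  also have "\<dots> \<le> KL P Q"
    using A AQ by (intro KL_ge_variational[OF P Q sets])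
      (auto simp: exp_g P.emeasure_eq_measure Q.emeasure_eq_measure)
  finally show ?thesis .
qed

text \<open>Turns the normalised logarithmic rate into the exponential bound that
  \<open>KL_ge_event\<close> takes, with t = c n. Where \<open>ext_log\<close> is -\<infinity>, x is
  at most 0 and any exponential exceeds it.\<close>

lemma measure_le_exp_if_ext_log_less:
  assumes "n > 0" and "ereal (inverse (real n)) * ext_log x < ereal (- c)"
  shows "x \<le> exp (- (c * real n))"
proof (cases "0 < x")
  case True
  with assms have "ln x < - (c * real n)"
    by (simp add: ext_log_def field_simps)
  with True have "x < exp (- (c * real n))"
    by (metis exp_less_mono exp_ln)
  then show ?thesis by simp
next
  case False
  then show ?thesis by (meson exp_ge_zero linorder_le_cases not_less order_trans)
qed

theorem lemma10:
  fixes P Q :: "nat \<Rightarrow> 'a measure"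
  assumes "\<And>n. prob_space (P n)"
    and "\<And>n. prob_space (Q n)"
    and "\<And>n. sets (P n) = sets (Q n)"
    and "Q \<stileturn> P"
  shows "liminf (\<lambda>n. ereal (inverse (real n)) * KL (P n) (Q n)) > 0"
proof -
  obtain A where A: "\<And>n. A n \<in> sets (P n)"
    and lim_P: "liminf (\<lambda>n. ereal (measure (P n) (A n))) > 0"
    and lim_Q: "limsup (\<lambda>n. ereal (inverse (real n)) * ext_log (measure (Q n) (A n))) < 0"
    using assms(4) by (auto simp: exp_separated_def)
  \<comment> \<open>Real levels strictly between 0 and each limit turn the liminf and limsup
    conditions into bounds valid for all large n: \<open>p\<close> for the P-probabilities,
    \<open>c = - b\<close> for the decay rate under Q.\<close>
  obtain p where p: "0 < ereal p" "ereal p < liminf (\<lambda>n. ereal (measure (P n) (A n)))"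
    using ereal_dense2[OF lim_P] by blast
  have ev_P: "\<forall>\<^sub>F n in sequentially. p < measure (P n) (A n)"
    using less_LiminfD[OF p(2)] by simp
  obtain b where b: "limsup (\<lambda>n. ereal (inverse (real n)) * ext_log (measure (Q n) (A n))) < ereal b"
    "ereal b < 0"
    using ereal_dense2[OF lim_Q] by blast
  define c where "c = - b"
  have ev_Q: "\<forall>\<^sub>F n in sequentially. ereal (inverse (real n)) * ext_log (measure (Q n) (A n)) < ereal (- c)"
    using Limsup_lessD[OF b(1)] by (simp add: c_def)
  have pos: "0 < c" "0 < p" using b p by (auto simp: c_def)
  \<comment> \<open>After division by n, the constant loss 1 in \<open>KL_ge_event\<close> becomes
    1/n, eventually less than half of the main term c p.\<close>
  have "\<forall>\<^sub>F n in sequentially. inverse (real n) < c * p / 2"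
    by (rule order_tendstoD[OF lim_inverse_n]) (use pos in simp)
  \<comment> \<open>Index 0 is discarded because \<open>inverse 0 = 0\<close> carries no rate
    information.\<close>
  with ev_P ev_Q eventually_gt_at_top[of "0::nat"]
  have "\<forall>\<^sub>F n in sequentially. ereal (c * p / 2) \<le> ereal (inverse (real n)) * KL (P n) (Q n)"
  proof eventually_elim
    case (elim n)
    have "ereal (c * real n * measure (P n) (A n) - 1) \<le> KL (P n) (Q n)"
      using elim by (intro KL_ge_event assms A measure_le_exp_if_ext_log_less)
    then have KL_n: "ereal (inverse (real n)) * ereal (c * real n * measure (P n) (A n) - 1)
        \<le> ereal (inverse (real n)) * KL (P n) (Q n)"
      by (intro ereal_mult_left_mono) auto
    have "c * p \<le> c * measure (P n) (A n)"
      using elim pos by (intro mult_left_mono) auto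
    then have "c * p / 2 \<le> c * measure (P n) (A n) - inverse (real n)"
      using elim by linarith
    also have "\<dots> = inverse (real n) * (c * real n * measure (P n) (A n) - 1)"
      using elim by (simp add: field_simps)
    finally show ?case
      by (intro order_trans[OF _ KL_n]) simp
  qed
  then have "ereal (c * p / 2) \<le> liminf (\<lambda>n. ereal (inverse (real n)) * KL (P n) (Q n))"
    by (rule Liminf_bounded)
  moreover have "0 < ereal (c * p / 2)"
    using pos by simp
  ultimately show ?thesis
    by (rule less_le_trans[rotated])
qed

end
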